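(* Suppose that $B:\mathbb{Z}_{\ge0}^2\to\mathbb{Z}$ has the double Lucas property and satisfies $B(n,k)=B(n,n-k)$ for all $0\le k\le n$. Then the sequence $$A(n)=\sum_{k=0}^n(-1)^kB(n,k)\binom{2n-3k}{n}$$ satisfies the Lucas congruences: for every prime $p$ and every $n\ge0$ with base-$p$ expansion $n=n_0+n_1p+\cdots+n_rp^r$, $A(n)\equiv A(n_0)A(n_1)\cdots A(n_r)\pmod p$.
   Context: For integers $m\ge0$ and any number $x$, $\binom{x}{m}=\frac{x(x-1)\cdots(x-m+1)}{m!}$ (so the upper entry $2n-3k$ may be negative). A function $B:\mathbb{Z}_{\ge0}^2\to\mathbb{Z}$ has the double Lucas property if $B(n,k)=0$ whenever $k>n$, and for every prime $p$ and all $n,k\ge0$, writing $n=\sum_{i=0}^r n_ip^i$, $k=\sum_{i=0}^r k_ip^i$ with base-$p$ digits $0\le n_i,k_i<p$ (padded with zeros to a common length), $B(n,k)\equiv\prod_{i=0}^r B(n_i,k_i)\pmod p$. *)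

theory Defs
  imports Complex_Main "HOL-Number_Theory.Number_Theory"
begin

definition base_digit :: "nat \<Rightarrow> nat \<Rightarrow> nat \<Rightarrow> nat" where
  "base_digit p n i = n div p ^ i mod p"

text \<open>
  The index \<open>r\<close> of the leading digit in the base-\<open>p\<close> expansion
  \<open>n = n\<^sub>0 + n\<^sub>1 p + \<dots> + n\<^sub>r p\<^sup>r\<close>; the number \<open>0\<close> has the single digit \<open>0\<close>, so \<open>r = 0\<close>.
\<close>
definition top_index :: "nat \<Rightarrow> nat \<Rightarrow> nat" where
  "top_index p n = (LEAST r. n < p ^ (r + 1))"

text \<open>
  The common length of the two expansions is that of the longer one. Longer padding is
  not required: it would in addition force \<open>B 0 0 = 1\<close> or \<open>B\<close> to vanish identically.
\<close>
definition double_lucas :: "(nat \<Rightarrow> nat \<Rightarrow> int) \<Rightarrow> bool" where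
  "double_lucas B \<longleftrightarrow>
     (\<forall>n k. k > n \<longrightarrow> B n k = 0) \<and>
     (\<forall>p n k. prime p \<longrightarrow>
        [B n k = (\<Prod>i = 0..top_index p (max n k). B (base_digit p n i) (base_digit p k i))]
          (mod int p))"

definition lucas_congruences :: "(nat \<Rightarrow> int) \<Rightarrow> bool" where
  "lucas_congruences A \<longleftrightarrow>
     (\<forall>p n. prime p \<longrightarrow> [A n = (\<Prod>i = 0..top_index p n. A (base_digit p n i))] (mod int p))"

text \<open>
  The library's \<open>gchoose\<close> is restricted by a sort constraint to fields of characteristic zero;
  this is its defining formula on integers. The division is exact, also for negative \<open>x\<close>.
\<close>
definition int_gchoose :: "int \<Rightarrow> nat \<Rightarrow> int" where
  "int_gchoose x m = (\<Prod>i = 0..<m. x - int i) div fact m"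

lemma of_int_int_gchoose: "(of_int (int_gchoose x m) :: 'a :: field_char_0) = of_int x gchoose m"
  unfolding int_gchoose_def using of_int_gbinomial[of x m, where 'a = 'a]
  by (simp only: gbinomial_prod_rev of_nat_id)

definition A_seq :: "(nat \<Rightarrow> nat \<Rightarrow> int) \<Rightarrow> nat \<Rightarrow> int" where
  "A_seq B n = (\<Sum>k = 0..n. (- 1) ^ k * B n k * int_gchoose (2 * int n - 3 * int k) n)"

end

theory Submission
  imports Defs
begin

text \<open>
  Write \<open>n = n\<^sub>0 + p n'\<close> and \<open>k = k\<^sub>0 + p k'\<close>. Lucas' congruence, which holds for all integer upper
  entries, splits \<open>binom (2n - 3k) n\<close> modulo \<open>p\<close> into a factor for \<open>(n\<^sub>0, k\<^sub>0)\<close> and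
  \<open>binom (2n' - 3k' + c) n'\<close>, where \<open>c\<close> is the carry of \<open>2n\<^sub>0 - 3k\<^sub>0\<close>, with \<open>c \<in> {-1, 0, 1}\<close>. For
  \<open>c = 1\<close> the first factor vanishes. For \<open>c = -1\<close> the reflection \<open>k' \<mapsto> n' - k'\<close> and the symmetry of
  \<open>B\<close> show that the sum over \<open>k'\<close> has the same value \<open>A n'\<close> as for \<open>c = 0\<close>.
\<close>

section \<open>Binomial coefficients with integer upper entry\<close>

lemma int_gchoose_0 [simp]: "int_gchoose x 0 = 1"
  by (simp add: int_gchoose_def)

lemma int_gchoose_eq_0:
  assumes "0 \<le> x" and "x < int m"
  shows "int_gchoose x m = 0"
proof -
  have "(\<Prod>i = 0..<m. x - int i) = 0"
    using assms by (intro prod_zero) (auto intro!: bexI[of _ "nat x"])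
  then show ?thesis
    by (simp only: int_gchoose_def div_0)
qed

text \<open>Like the two lemmas after it, this is pulled back from \<open>gchoose\<close> along the
  embedding of the integers into the reals, so the \<open>div\<close> in \<open>int_gchoose\<close>
  never has to be handled.\<close>

lemma int_gchoose_Suc_Suc:
  "int_gchoose (x + 1) (Suc m) = int_gchoose x m + int_gchoose x (Suc m)"
proof -
  have "real_of_int (int_gchoose (x + 1) (Suc m)) =
      real_of_int (int_gchoose x m + int_gchoose x (Suc m))"
    using gbinomial_Suc_Suc[of "real_of_int x" m] by (simp add: of_int_int_gchoose)
  then show ?thesis
    by linarith
qed

lemma int_gchoose_of_nat: "int_gchoose (int n) m = int (n choose m)"
proof -
  have "real_of_int (int_gchoose (int n) m) = real_of_int (int (n choose m))"
    by (simp add: of_int_int_gchoose binomial_gbinomial)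
  then show ?thesis
    by linarith
qed

lemma int_gchoose_reflect: "int_gchoose x m = (-1) ^ m * int_gchoose (int m - x - 1) m"
proof -
  have "real_of_int (int_gchoose x m) = real_of_int ((-1) ^ m * int_gchoose (int m - x - 1) m)"
    using gbinomial_negated_upper[of "real_of_int x" m] by (simp add: of_int_int_gchoose)
  then show ?thesis
    by linarith
qed

section \<open>Lucas' congruence for integer upper entries\<close>

text \<open>Pascal's rule can be run in both directions: it determines column \<open>Suc m\<close>
  at \<open>x + 1\<close> from \<open>x\<close>, and also at \<open>x - 1\<close> from
  \<open>x\<close>, so the boundary values reach negative \<open>x\<close> too.\<close>

lemma pascal_recurrence_unique_mod:
  fixes f g :: "int \<Rightarrow> nat \<Rightarrow> int"
  assumes f: "\<And>x m. [f (x + 1) (Suc m) = f x m + f x (Suc m)] (mod q)"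
    and g: "\<And>x m. [g (x + 1) (Suc m) = g x m + g x (Suc m)] (mod q)"
    and column: "\<And>x. [f x 0 = g x 0] (mod q)"
    and row: "\<And>m. [f 0 m = g 0 m] (mod q)"
  shows "[f x m = g x m] (mod q)"
proof (induction m arbitrary: x)
  case 0
  show ?case by (rule column)
next
  case (Suc m)
  show ?case
  proof (induction x rule: int_induct[where k = 0])
    case base
    show ?case by (rule row)
  next
    case (step1 x)
    show ?case
      using cong_trans[OF f[of x m] cong_trans[OF cong_add[OF Suc step1(2)] cong_sym[OF g[of x m]]]] .
  next
    case (step2 x)
    have "[f (x - 1) m + f (x - 1) (Suc m) = g (x - 1) m + g (x - 1) (Suc m)] (mod q)"
      using cong_trans[OF cong_sym[OF f[of "x - 1" m]]
          cong_trans[OF _ g[of "x - 1" m]]] step2(2) by simp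
    from cong_diff[OF this Suc[of "x - 1"]] show ?case by simp
  qed
qed

lemma div_mod_add_1_no_carry:
  fixes x :: int
  assumes "0 < p" and "x mod p + 1 < p"
  shows "(x + 1) div p = x div p" and "(x + 1) mod p = x mod p + 1"
proof -
  have "x + 1 = p * (x div p) + (x mod p + 1)"
    by simp
  moreover have "0 \<le> x mod p + 1"
    using assms(1) pos_mod_sign[of p x] by linarith
  ultimately show "(x + 1) div p = x div p" and "(x + 1) mod p = x mod p + 1"
    using assms(2) by (rule int_div_pos_eq, rule int_mod_pos_eq)
qed

lemma div_mod_add_1_carry:
  fixes x :: int
  assumes "0 < p" and "x mod p + 1 = p"
  shows "(x + 1) div p = x div p + 1" and "(x + 1) mod p = 0"
proof -
  have "x + 1 = p * (x div p + 1)"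
    using assms(2) mult_div_mod_eq[of p x] by (simp only: distrib_left mult_1_right)
  then show "(x + 1) div p = x div p + 1" and "(x + 1) mod p = 0"
    using assms(1) by simp_all
qed

text \<open>The product on the right has the boundary values of \<open>int_gchoose\<close> and obeys
  Pascal's rule modulo \<open>p\<close>. The rule is checked in four cases, according to whether
  adding 1 to \<open>x\<close> and to \<open>m\<close> carries into the quotient.\<close>

lemma int_gchoose_lucas:
  assumes p: "prime p"
  shows "[int_gchoose x m =
      int_gchoose (x div int p) (m div p) * int_gchoose (x mod int p) (m mod p)] (mod int p)"
proof -
  define f where
    "f x m = int_gchoose (x div int p) (m div p) * int_gchoose (x mod int p) (m mod p)" for x m
  have p1: "1 < p" and p0: "0 < int p"
    using p prime_gt_1_nat prime_gt_0_nat by auto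
  have "[int_gchoose x m = f x m] (mod int p)"
  proof (rule pascal_recurrence_unique_mod[where f = int_gchoose and g = f])
    show "[int_gchoose (x + 1) (Suc m) = int_gchoose x m + int_gchoose x (Suc m)] (mod int p)" for x m
      by (simp add: int_gchoose_Suc_Suc)
    show "[int_gchoose x 0 = f x 0] (mod int p)" for x
      by (simp add: f_def)
    show "[int_gchoose 0 m = f 0 m] (mod int p)" for m
    proof (cases "m = 0")
      case False
      then have "m div p \<noteq> 0 \<or> m mod p \<noteq> 0"
        by (metis add_0 mult_0 div_mult_mod_eq)
      then show ?thesis
        using False by (auto simp: f_def int_gchoose_eq_0)
    qed (simp add: f_def)
    show "[f (x + 1) (Suc m) = f x m + f x (Suc m)] (mod int p)" for x m
    proof -
      define a where "a = x div int p"
      define r where "r = x mod int p"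
      define q where "q = m div p"
      define c where "c = m mod p"
      have r: "0 \<le> r" "r < int p"
        using p0 by (simp_all add: r_def)
      consider (lt) "r + 1 < int p" | (eq) "r + 1 = int p"
        using r by linarith
      then show ?thesis
      proof cases
        case lt
        note x1 = div_mod_add_1_no_carry[OF p0 lt[unfolded r_def]]
        show ?thesis
        proof (cases "Suc c = p")
          case True
          then have m1: "Suc m div p = Suc q" "Suc m mod p = 0"
            using p1 by (auto simp: div_Suc mod_Suc c_def q_def)
          \<comment> \<open>Only \<open>m\<close> carries: \<open>c = p - 1\<close> exceeds
            \<open>r\<close>, so the term \<open>f x m\<close> drops out.\<close>
          have "int_gchoose r c = 0"
            using True lt r by (intro int_gchoose_eq_0) auto
          then show ?thesis
            by (simp add: f_def x1 m1 flip: a_def r_def q_def c_def)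
        next
          case False
          then have m1: "Suc m div p = q" "Suc m mod p = Suc c"
            by (auto simp: div_Suc mod_Suc c_def q_def)
          show ?thesis
            by (simp add: f_def x1 m1 int_gchoose_Suc_Suc distrib_left flip: a_def r_def q_def c_def)
        qed
      next
        case eq
        note x1 = div_mod_add_1_carry[OF p0 eq[unfolded r_def]]
        show ?thesis
        proof (cases "Suc c = p")
          case True
          then have m1: "Suc m div p = Suc q" "Suc m mod p = 0"
            using p1 by (auto simp: div_Suc mod_Suc c_def q_def)
          \<comment> \<open>Both carry: the low factors are all 1, and what remains is Pascal's rule
            for the quotients.\<close>
          have "r = int c"
            using True eq by linarith
          then have "int_gchoose r c = 1"
            by (simp add: int_gchoose_of_nat)
          then show ?thesis
            by (simp add: f_def x1 m1 int_gchoose_Suc_Suc flip: a_def r_def q_def c_def)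
        next
          case False
          then have m1: "Suc m div p = q" "Suc m mod p = Suc c"
            by (auto simp: div_Suc mod_Suc c_def q_def)
          \<comment> \<open>Only \<open>x\<close> carries, the one case where the rule can fail over
            the integers: the left side is 0, the right side a multiple of
            \<open>p choose Suc c\<close>.\<close>
          have "Suc c < p"
            using False p1 mod_less_divisor[of p m] unfolding c_def by linarith
          then have "p dvd p choose Suc c"
            using p by (intro dvd_choose_prime) auto
          then have "int p dvd int_gchoose r c + int_gchoose r (Suc c)"
            by (simp add: int_gchoose_of_nat eq flip: int_gchoose_Suc_Suc)
          then have "[0 = int_gchoose a q * (int_gchoose r c + int_gchoose r (Suc c))] (mod int p)"
            by (intro cong_sym[of _ 0]) (simp add: cong_0_iff)
          moreover have "f (x + 1) (Suc m) = 0"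
            by (simp add: f_def x1 m1 int_gchoose_eq_0)
          moreover have "f x m + f x (Suc m) =
              int_gchoose a q * (int_gchoose r c + int_gchoose r (Suc c))"
            by (simp add: f_def m1 distrib_left flip: a_def r_def q_def c_def)
          ultimately show ?thesis
            by simp
        qed
      qed
    qed
  qed
  then show ?thesis
    by (simp add: f_def)
qed

lemma int_gchoose_mod_upper:
  assumes "prime p" and "m < p"
  shows "[int_gchoose x m = int_gchoose (x mod int p) m] (mod int p)"
  using int_gchoose_lucas[OF assms(1), of x m] assms(2) by simp

section \<open>Splitting off the lowest digit\<close>

lemma base_digit_Suc: "base_digit p n (Suc i) = base_digit p (n div p) i"
  by (simp add: base_digit_def div_mult2_eq)

lemma base_digit_0: "base_digit p n 0 = n mod p"
  by (simp add: base_digit_def)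

lemma top_index_eq_0: "n < p \<Longrightarrow> top_index p n = 0"
  unfolding top_index_def by (rule Least_eq_0) simp

lemma top_index_Suc:
  assumes "1 < p" and "p \<le> n"
  shows "top_index p n = Suc (top_index p (n div p))"
proof -
  \<comment> \<open>The bound serves as a witness that the \<open>LEAST\<close> in
    \<open>top_index\<close> is attained, as \<open>Least_Suc\<close> requires.\<close>
  have "n < 2 ^ n"
    by (rule less_exp)
  also have "\<dots> \<le> p ^ n"
    using assms by (intro power_mono) auto
  also have "\<dots> \<le> p ^ (n + 1)"
    using assms by (intro power_increasing) auto
  finally have "n < p ^ (n + 1)" .
  then have "top_index p n = Suc (LEAST r. n < p ^ (Suc r + 1))"
    unfolding top_index_def using assms by (intro Least_Suc) auto
  also have "(\<lambda>r. n < p ^ (Suc r + 1)) = (\<lambda>r. n div p < p ^ (r + 1))"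
    using assms by (simp add: div_less_iff_less_mult mult_ac)
  finally show ?thesis
    by (simp add: top_index_def)
qed

text \<open>The lowest pair of digits is split off, and the remaining product is folded back by the
  same property. Since \<open>p \<le> n\<close>, there is a second pair; for one-digit
  \<open>n\<close> and \<open>k\<close> a factor \<open>B 0 0\<close> would appear, which need not
  be 1.\<close>

lemma double_lucas_div_mod:
  assumes B: "double_lucas B" and p: "prime p" and n: "p \<le> n"
  shows "[B n k = B (n mod p) (k mod p) * B (n div p) (k div p)] (mod int p)"
proof -
  have p1: "1 < p"
    using p by (rule prime_gt_1_nat)
  define t where "t = max n k"
  have "t div p = max (n div p) (k div p)"
    unfolding t_def by (simp add: max_def div_le_mono antisym)
  moreover have "p \<le> t"
    using n by (simp add: t_def)
  ultimately have top: "top_index p t = Suc (top_index p (max (n div p) (k div p)))"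
    using top_index_Suc[OF p1] by simp
  have lucas: "[B n k = (\<Prod>i = 0..top_index p (max n k). B (base_digit p n i) (base_digit p k i))]
      (mod int p)" for n k
    using B p by (simp add: double_lucas_def)
  have "[B n k = B (n mod p) (k mod p) *
      (\<Prod>i = 0..top_index p (max (n div p) (k div p)).
        B (base_digit p (n div p) i) (base_digit p (k div p) i))] (mod int p)"
    using lucas[of n k]
    by (simp add: top[unfolded t_def] prod.atLeast0_atMost_Suc_shift base_digit_0 base_digit_Suc
        del: prod.cl_ivl_Suc)
  then show ?thesis
    using cong_trans cong_scalar_left[OF cong_sym[OF lucas]] by blast
qed

text \<open>Induction on the number of digits. For \<open>n < p\<close> the product is the single
  factor \<open>A n\<close>, so nothing is asked of \<open>A 0\<close>.\<close>

lemma lucas_congruencesI: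
  assumes "\<And>p n. prime p \<Longrightarrow> p \<le> n \<Longrightarrow> [A n = A (n mod p) * A (n div p)] (mod int p)"
  shows "lucas_congruences A"
  unfolding lucas_congruences_def
proof (intro allI impI)
  fix p n :: nat
  assume p: "prime p"
  have p1: "1 < p"
    using p by (rule prime_gt_1_nat)
  show "[A n = (\<Prod>i = 0..top_index p n. A (base_digit p n i))] (mod int p)"
  proof (induction n rule: less_induct)
    case (less n)
    show ?case
    proof (cases "n < p")
      case True
      then show ?thesis
        by (simp add: top_index_eq_0 base_digit_0)
    next
      case False
      then have "n div p < n"
        using p1 by simp
      then have "[A n = A (n mod p) *
          (\<Prod>i = 0..top_index p (n div p). A (base_digit p (n div p) i))] (mod int p)"
        using assms[OF p, of n] less cong_scalar_left cong_trans False by (meson not_less)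
      then show ?thesis
        using False
        by (simp add: top_index_Suc[OF p1] prod.atLeast0_atMost_Suc_shift base_digit_0 base_digit_Suc
            del: prod.cl_ivl_Suc)
    qed
  qed
qed

section \<open>Signs and sums split by residue\<close>

text \<open>For odd \<open>p\<close> the power \<open>(-1) ^ p\<close> is \<open>-1\<close>; for
  \<open>p = 2\<close> signs are invisible.\<close>

lemma minus_one_power_mod_prime:
  assumes "prime p"
  shows "[(-1) ^ (j + p * i) = (-1) ^ j * (-1) ^ i] (mod int p)"
proof (cases "p = 2")
  case True
  have "[(-1) ^ j = 1] (mod (2 :: int))" for j
    using cong_pow[of "-1" 1 "2 :: int" j] by (simp add: cong_def)
  from this[of "j + p * i"] this[of "j + i"] show ?thesis
    unfolding True by (simp add: power_add cong_def)
next
  case False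
  then have "odd p"
    using assms primes_dvd_imp_eq two_is_prime_nat by blast
  then show ?thesis
    by (simp add: power_add power_mult)
qed

lemma sum_lessThan_mult_div_mod:
  fixes f :: "nat \<Rightarrow> 'a :: comm_monoid_add"
  shows "sum f {..<N * p} = (\<Sum>i<N. \<Sum>j<p. f (j + p * i))"
proof -
  have "sum f {i * p..<i * p + p} = (\<Sum>j<p. f (j + p * i))" for i
    using sum.shift_bounds_nat_ivl[of f 0 "i * p" p]
    by (simp add: atLeast0LessThan mult.commute add.commute)
  then show ?thesis
    by (simp flip: sum.nat_group)
qed

section \<open>Carries and the reflection symmetry\<close>

definition shifted_A_seq :: "(nat \<Rightarrow> nat \<Rightarrow> int) \<Rightarrow> nat \<Rightarrow> int \<Rightarrow> int" where
  "shifted_A_seq B n c = (\<Sum>k = 0..n. (- 1) ^ k * B n k * int_gchoose (2 * int n - 3 * int k + c) n)"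

lemma shifted_A_seq_0: "shifted_A_seq B n 0 = A_seq B n"
  by (simp add: shifted_A_seq_def A_seq_def)

text \<open>Reversing the sum makes the upper entry \<open>3k - n - 1\<close>, which the negation
  rule for binomials turns into \<open>2n - 3k\<close> at the cost of a sign
  \<open>(-1) ^ n\<close>.\<close>

lemma shifted_A_seq_minus_1:
  assumes "\<And>n k. k \<le> n \<Longrightarrow> B n k = B n (n - k)"
  shows "shifted_A_seq B n (-1) = A_seq B n"
proof -
  have "shifted_A_seq B n (-1) = (\<Sum>k = 0..n. (- 1) ^ (n - k) * B n (n - k) *
      int_gchoose (2 * int n - 3 * int (n - k) + -1) n)"
    unfolding shifted_A_seq_def
    by (subst sum.atLeastAtMost_rev) simp
  also have "\<dots> = A_seq B n"
    unfolding A_seq_def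
  proof (rule sum.cong[OF refl])
    fix k assume "k \<in> {0..n}"
    then have k: "k \<le> n" by simp
    have "int_gchoose (2 * int n - 3 * int (n - k) + -1) n =
        (-1) ^ n * int_gchoose (2 * int n - 3 * int k) n"
      using int_gchoose_reflect[of "2 * int n - 3 * int (n - k) + -1" n] k
      by (simp add: of_nat_diff algebra_simps)
    moreover have "(-1) ^ (n - k) * (-1) ^ n = ((-1) ^ k :: int)"
      using k by (simp flip: power_add add: minus_one_power_iff)
    then have "(-1) ^ (n - k) * b * ((-1) ^ n * c) = (-1) ^ k * b * c" for b c :: int
      by (metis mult.assoc mult.commute)
    ultimately show "(- 1) ^ (n - k) * B n (n - k) *
        int_gchoose (2 * int n - 3 * int (n - k) + -1) n =
        (- 1) ^ k * B n k * int_gchoose (2 * int n - 3 * int k) n"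
      using assms[OF k] by simp
  qed
  finally show ?thesis .
qed

section \<open>The one-digit congruence for the sequence\<close>

lemma A_seq_div_mod:
  assumes B: "double_lucas B" and sym: "\<And>n k. k \<le> n \<Longrightarrow> B n k = B n (n - k)"
    and p: "prime p" and n: "p \<le> n"
  shows "[A_seq B n = A_seq B (n mod p) * A_seq B (n div p)] (mod int p)"
proof -
  define m where "m = n div p"
  define l where "l = n mod p"
  define b where "b j = 2 * int l - 3 * int j" for j
  define F where "F k = (- 1) ^ k * B n k * int_gchoose (2 * int n - 3 * int k) n" for k
  define H where "H i c = (- 1) ^ i * B m i * int_gchoose (2 * int m - 3 * int i + c) m" for i c
  define G where "G j = (- 1) ^ j * B l j" for j
  have p0: "0 < p"
    using p by (rule prime_gt_0_nat)
  have l: "l < p"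
    using p0 by (simp add: l_def)
  have nlm: "n = l + p * m"
    by (simp add: l_def m_def)
  have zero: "B n k = 0" if "n < k" for n k
    using B that by (simp add: double_lucas_def)
  \<comment> \<open>The range is filled up to whole blocks of length \<open>p\<close>; the added
    terms have \<open>k > n\<close>, where \<open>B n k = 0\<close>.\<close>
  have A: "A_seq B n = sum F {..<Suc m * p}"
    unfolding A_seq_def F_def using l
    by (intro sum.mono_neutral_left) (auto simp: nlm zero algebra_simps)
  have factor: "[F (j + p * i) = G j * int_gchoose (b j mod int p) l * H i (b j div int p)] (mod int p)"
    if "j < p" for i j
  proof -
    define k where "k = j + p * i"
    have k: "k mod p = j" "k div p = i"
      using that by (simp_all add: k_def)
    \<comment> \<open>Here \<open>b j\<close> need not be a residue: its quotient by
      \<open>p\<close> is the carry added to \<open>2m - 3i\<close>.\<close>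
    have x: "2 * int n - 3 * int k = b j + int p * (2 * int m - 3 * int i)"
      by (simp add: nlm k_def b_def algebra_simps)
    have "[int_gchoose (2 * int n - 3 * int k) n =
        int_gchoose (2 * int m - 3 * int i + b j div int p) m * int_gchoose (b j mod int p) l] (mod int p)"
      using int_gchoose_lucas[OF p, of "2 * int n - 3 * int k" n] p0
      by (simp add: x add.commute flip: m_def l_def)
    moreover have "[B n k = B l j * B m i] (mod int p)"
      using double_lucas_div_mod[OF B p n, of k] by (simp add: k m_def l_def)
    moreover have "[(- 1) ^ k = (- 1) ^ j * (- 1) ^ i] (mod int p)"
      using minus_one_power_mod_prime[OF p] by (simp add: k_def)
    ultimately have "[F k = ((- 1) ^ j * (- 1) ^ i) * (B l j * B m i) *
       (int_gchoose (2 * int m - 3 * int i + b j div int p) m * int_gchoose (b j mod int p) l)] (mod int p)"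
      unfolding F_def by (intro cong_mult)
    then show ?thesis
      by (simp add: G_def H_def k_def mult_ac)
  qed
  have inner: "[G j * int_gchoose (b j mod int p) l * shifted_A_seq B m (b j div int p) =
      G j * int_gchoose (b j) l * A_seq B m] (mod int p)" for j
  proof (cases "j \<le> l")
    case False
    then show ?thesis by (simp add: G_def zero)
  next
    case True
    \<comment> \<open>From \<open>j \<le> l\<close> follows \<open>-l \<le> b j \<le> 2l\<close>, so
      the carry is -1, 0 or 1.\<close>
    have bj: "- int p \<le> b j" "b j < 2 * int p"
      using True l by (simp_all add: b_def)
    have upper: "[int_gchoose (b j) l = int_gchoose (b j mod int p) l] (mod int p)"
      using p l by (rule int_gchoose_mod_upper)
    consider (neg) "b j < 0" | (mid) "0 \<le> b j" "b j < int p" | (big) "int p \<le> b j"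
      by linarith
    then have "int_gchoose (b j mod int p) l * shifted_A_seq B m (b j div int p) =
        int_gchoose (b j mod int p) l * A_seq B m"
    proof cases
      case neg
      then have "b j div int p = -1"
        using bj by (intro int_div_pos_eq[of _ _ _ "b j + int p"]) auto
      moreover have "shifted_A_seq B m (-1) = A_seq B m"
        by (intro shifted_A_seq_minus_1 sym)
      ultimately show ?thesis
        by simp
    next
      case mid
      then show ?thesis by (simp add: shifted_A_seq_0)
    next
      case big
      then have "b j mod int p = b j - int p"
        using bj by (intro int_mod_pos_eq[of _ _ 1]) auto
      \<comment> \<open>The residue is at most \<open>2l - p\<close>, hence less than
        \<open>l\<close>.\<close>
      then have "int_gchoose (b j mod int p) l = 0"
        using big l by (intro int_gchoose_eq_0) (auto simp: b_def)
      then show ?thesis by simp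
    qed
    then have "G j * int_gchoose (b j mod int p) l * shifted_A_seq B m (b j div int p) =
        G j * (int_gchoose (b j mod int p) l * A_seq B m)"
      by (simp add: mult.assoc)
    moreover have "[G j * (int_gchoose (b j mod int p) l * A_seq B m) =
        G j * (int_gchoose (b j) l * A_seq B m)] (mod int p)"
      by (intro cong_scalar_left cong_scalar_right cong_sym[OF upper])
    ultimately show ?thesis
      by (simp only: mult.assoc)
  qed
  have "A_seq B n = (\<Sum>i<Suc m. \<Sum>j<p. F (j + p * i))"
    unfolding A by (rule sum_lessThan_mult_div_mod)
  also have "[\<dots> = (\<Sum>i<Suc m. \<Sum>j<p. G j * int_gchoose (b j mod int p) l * H i (b j div int p))]
      (mod int p)"
    by (intro cong_sum factor) simp
  \<comment> \<open>For fixed \<open>j\<close> the carry is the same for all \<open>i\<close>, so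
    the sum of \<open>H\<close> over \<open>i\<close> is a shifted sequence.\<close>
  also have "(\<Sum>i<Suc m. \<Sum>j<p. G j * int_gchoose (b j mod int p) l * H i (b j div int p)) =
      (\<Sum>j<p. G j * int_gchoose (b j mod int p) l * shifted_A_seq B m (b j div int p))"
    by (subst sum.swap)
      (simp only: H_def shifted_A_seq_def sum_distrib_left lessThan_Suc_atMost atMost_atLeast0)
  also have "[\<dots> = (\<Sum>j<p. G j * int_gchoose (b j) l * A_seq B m)] (mod int p)"
    by (intro cong_sum inner)
  also have "(\<Sum>j<p. G j * int_gchoose (b j) l * A_seq B m) =
      (\<Sum>j<p. G j * int_gchoose (b j) l) * A_seq B m"
    by (simp add: sum_distrib_right)
  \<comment> \<open>The digits \<open>j > l\<close> contribute nothing, since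
    \<open>B l j = 0\<close>.\<close>
  also have "(\<Sum>j<p. G j * int_gchoose (b j) l) = A_seq B l"
    unfolding A_seq_def G_def b_def using l
    by (intro sum.mono_neutral_right) (auto simp: zero)
  finally show ?thesis
    by (simp add: m_def l_def)
qed

theorem theorem4p1:
  fixes B :: "nat \<Rightarrow> nat \<Rightarrow> int"
  assumes "double_lucas B"
    and "\<And>n k. k \<le> n \<Longrightarrow> B n k = B n (n - k)"
  shows "lucas_congruences (A_seq B)"
  by (intro lucas_congruencesI A_seq_div_mod assms)

end
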